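(* Let $f\in\mathcal{A}$, $f(z)=z+\sum_{n=2}^{\infty}a_nz^n$. Then $f\in\mathcal{G}_{sh}$ if and only if for every $\theta\in[0,2\pi)$ and every $z\in\mathbb{D}$, $$1-\sum_{n=2}^{\infty}\frac{n-\left(1+\sinh(e^{i\theta})\right)}{\sinh(e^{i\theta})}\,a_nz^{n-1}\neq0.$$
   Context: $\mathbb{D}=\{z\in\mathbb{C}:|z|<1\}$. $\mathcal{A}$ is the class of analytic functions on $\mathbb{D}$ of the form $f(z)=z+\sum_{n=2}^\infty a_nz^n$. Subordination: $f_1\prec f_2$ means there is a Schwarz function $\omega$ (analytic on $\mathbb{D}$, $|\omega(z)|\le|z|$) with $f_1(z)=f_2(\omega(z))$ for $z\in\mathbb{D}$. The class $\mathcal{G}_{sh}$ is $$\mathcal{G}_{sh}=\left\{f\in\mathcal{A}:\frac{zf'(z)}{f(z)}-1\prec\sinh(z)\right\}.$$ *)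

theory Defs
  imports "HOL-Complex_Analysis.Complex_Analysis"
begin

abbreviation unit_disc :: "complex set"  ("\<bbbD>")
  where "\<bbbD> \<equiv> ball 0 1"

(* f(z) = z + sum_{n >= 2} a_n z^n on the disc, the sum reindexed to start at 0;
   the values a 0 and a 1 play no role. *)
definition normalized_expansion :: "(nat \<Rightarrow> complex) \<Rightarrow> (complex \<Rightarrow> complex) \<Rightarrow> bool" where
  "normalized_expansion a f \<longleftrightarrow> (\<forall>z\<in>\<bbbD>. (\<lambda>n. a (n + 2) * z ^ (n + 2)) sums (f z - z))"

(* Functions are total; only the values on the disc are constrained. *)
definition class_A :: "(complex \<Rightarrow> complex) set" where
  "class_A = {f. f analytic_on \<bbbD> \<and> (\<exists>a. normalized_expansion a f)}"

definition schwarz_function :: "(complex \<Rightarrow> complex) \<Rightarrow> bool" where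
  "schwarz_function \<omega> \<longleftrightarrow> \<omega> analytic_on \<bbbD> \<and> (\<forall>z\<in>\<bbbD>. norm (\<omega> z) \<le> norm z)"

definition subordinate :: "(complex \<Rightarrow> complex) \<Rightarrow> (complex \<Rightarrow> complex) \<Rightarrow> bool"  (infix "\<prec>\<^sub>D" 50) where
  "f\<^sub>1 \<prec>\<^sub>D f\<^sub>2 \<longleftrightarrow> (\<exists>\<omega>. schwarz_function \<omega> \<and> (\<forall>z\<in>\<bbbD>. f\<^sub>1 z = f\<^sub>2 (\<omega> z)))"

(* z f'(z) / f(z), whose removable singularity at 0 is filled in with the limit 1
   (the limit for every f in class_A). *)
definition zf'_over_f :: "(complex \<Rightarrow> complex) \<Rightarrow> complex \<Rightarrow> complex" where
  "zf'_over_f f z = (if z = 0 then 1 else z * deriv f z / f z)"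

(* The nonvanishing condition says that the quotient is defined on the whole disc,
   so that HOL's convention x / 0 = 0 is never used. *)
definition class_G_sh :: "(complex \<Rightarrow> complex) set" where
  "class_G_sh = {f \<in> class_A.
     (\<forall>z\<in>\<bbbD> - {0}. f z \<noteq> 0) \<and> (\<lambda>z. zf'_over_f f z - 1) \<prec>\<^sub>D sinh}"

end

theory Submission imports Defs begin

text \<open>
  Write \<open>h z = f z / z\<close> with \<open>h 0 = 1\<close>. Summing the series shows that the expression in question equals
  \<open>((1 + sinh w) * h z - f' z) / sinh w\<close> with \<open>w = exp (i \<theta>)\<close>, so the condition says that \<open>f' = (1 + sinh w) * h\<close>
  has no solution \<open>z\<close> in the disc for \<open>w\<close> on the unit circle. Since \<open>sinh\<close> is injective on the closed
  disc, this follows from subordination. Conversely, removing the countably many zeros of \<open>h\<close>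
  leaves a connected set on which \<open>f' / h\<close> avoids the image of the circle, so it stays inside the image of the
  open disc. Then \<open>|f'| \<le> C * |h|\<close> by density, so a zero of \<open>h\<close> would be a zero of \<open>f'\<close>,
  which the condition forbids. The Schwarz function is the inverse of \<open>1 + sinh\<close> composed with \<open>f' / h\<close>.
\<close>

text \<open>Equal values of \<open>sinh\<close> force \<open>z - w\<close> to be an even, or
  \<open>z + w\<close> an odd, integer multiple of i pi. Both have norm at most 2 < pi, so the
  multiple is 0: this gives \<open>z = w\<close> in the even case and is absurd in the odd
  one.\<close>

lemma inj_on_sinh_cball: "inj_on (sinh :: complex \<Rightarrow> complex) (cball 0 1)"
proof (rule inj_onI)
  fix z w :: complex
  assume z: "z \<in> cball 0 1" and w: "w \<in> cball 0 1" and eq: "sinh z = sinh w"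
  from eq obtain n where "n \<in> \<int>" and
    n: "z = w - 2 * \<i> * of_real n * of_real pi \<or> z = - (2 * of_real n + 1) * \<i> * of_real pi - w"
    by (auto simp: sinh_complex_eq_iff)
  then obtain k :: int where k: "n = of_int k" by (auto elim: Ints_cases)
  have bound: "m = 0" if "norm (of_int m * \<i> * of_real pi :: complex) \<le> 2" for m :: int
  proof (rule ccontr)
    assume "m \<noteq> 0"
    then have "1 * pi \<le> \<bar>of_int m\<bar> * pi" by (intro mult_right_mono) auto
    with that pi_gt3 show False by (simp add: norm_mult)
  qed
  from n show "z = w"
  proof
    assume 1: "z = w - 2 * \<i> * of_real n * of_real pi"
    then have "w - z = of_int (2 * k) * \<i> * of_real pi" by (simp add: k)
    moreover have "norm (w - z) \<le> 2" using norm_triangle_ineq4[of w z] z w by simp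
    ultimately have "2 * k = 0" by (intro bound) simp
    then show ?thesis using 1 k by simp
  next
    assume "z = - (2 * of_real n + 1) * \<i> * of_real pi - w"
    then have "z + w = of_int (- (2 * k + 1)) * \<i> * of_real pi" by (simp add: k)
    moreover have "norm (z + w) \<le> 2" using norm_triangle_ineq[of z w] z w by simp
    ultimately have "- (2 * k + 1) = 0" by (intro bound) simp
    then have False by presburger
    then show ?thesis ..
  qed
qed

text \<open>The left side is a product equation, not one about \<open>p z / q z\<close>, so that it
  also carries information at zeros of \<open>q\<close>. It is used with \<open>p\<close> the
  derivative of \<open>f\<close>, \<open>q\<close> the function f(z)/z and \<open>\<phi>\<close>
  equal to 1 + sinh.\<close>

lemma avoids_circle_iff_subordinate:
  fixes p q \<phi> :: "complex \<Rightarrow> complex"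
  assumes p: "p holomorphic_on \<bbbD>" and q: "q holomorphic_on \<bbbD>"
    and \<phi>: "\<phi> holomorphic_on \<bbbD>" "continuous_on (cball 0 1) \<phi>" "inj_on \<phi> (cball 0 1)"
    and q0: "q 0 \<noteq> 0" and p0: "p 0 = \<phi> 0 * q 0"
  shows "(\<forall>w\<in>sphere 0 1. \<forall>z\<in>\<bbbD>. p z \<noteq> \<phi> w * q z) \<longleftrightarrow>
         (\<forall>z\<in>\<bbbD>. q z \<noteq> 0) \<and> (\<lambda>z. p z / q z) \<prec>\<^sub>D \<phi>"
proof (intro iffI conjI)
  assume R: "(\<forall>z\<in>\<bbbD>. q z \<noteq> 0) \<and> (\<lambda>z. p z / q z) \<prec>\<^sub>D \<phi>"
  then obtain \<omega> where \<omega>: "schwarz_function \<omega>" "\<And>z. z \<in> \<bbbD> \<Longrightarrow> p z / q z = \<phi> (\<omega> z)"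
    unfolding subordinate_def by auto
  show "\<forall>w\<in>sphere 0 1. \<forall>z\<in>\<bbbD>. p z \<noteq> \<phi> w * q z"
  proof (intro ballI notI)
    fix w z :: complex
    assume w: "w \<in> sphere 0 1" and z: "z \<in> \<bbbD>" and eq: "p z = \<phi> w * q z"
    \<comment> \<open>An interior point is compared with a boundary point, hence injectivity on the
      closed disc.\<close>
    have "\<phi> (\<omega> z) = \<phi> w" using \<omega>(2)[OF z] R z eq by auto
    moreover have "norm (\<omega> z) < 1"
      using \<omega>(1) z le_less_trans[of "norm (\<omega> z)" "norm z" 1] by (simp add: schwarz_function_def)
    ultimately have "\<omega> z = w"
      using w inj_onD[OF \<phi>(3), of "\<omega> z" w] by simp
    with \<open>norm (\<omega> z) < 1\<close> w show False by simp
  qed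
next
  assume L: "\<forall>w\<in>sphere 0 1. \<forall>z\<in>\<bbbD>. p z \<noteq> \<phi> w * q z"
  define Z where "Z = {z \<in> \<bbbD>. q z = 0}"
  have inj: "inj_on \<phi> \<bbbD>" by (rule inj_on_subset[OF \<phi>(3)]) auto
  have cmp: "compact (\<phi> ` cball 0 1)" using \<phi>(2) by (intro compact_continuous_image) auto
  have opn: "open (\<phi> ` \<bbbD>)" by (rule open_mapping_thm3[OF \<phi>(1) _ inj]) auto
  have cZ: "countable Z"
  proof (cases "q constant_on \<bbbD>")
    case True
    then have "Z = {}" using q0 unfolding Z_def constant_on_def by force
    then show ?thesis by simp
  next
    case False
    \<comment> \<open>The theorem on countability of zeros asks for an F-sigma domain; an exhaustion
      by compact sets provides it.\<close>
    obtain F :: "nat \<Rightarrow> complex set" where "\<And>n. compact (F n)" "\<Union>(range F) = \<bbbD>"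
      using open_Union_compact_subsets[of \<bbbD>] by (metis open_ball)
    then have "fsigma \<bbbD>" using fsigma.intros[of F] compact_imp_closed by metis
    then show ?thesis
      unfolding Z_def using q False by (intro holomorphic_countable_zeros) auto
  qed
  define g where "g z = p z / q z" for z
  have con: "connected (g ` (\<bbbD> - Z))"
  proof (rule connected_continuous_image)
    show "continuous_on (\<bbbD> - Z) g"
      unfolding g_def Z_def using p q
      by (intro continuous_intros) (auto intro: holomorphic_on_imp_continuous_on holomorphic_on_subset)
    show "connected (\<bbbD> - Z)" using cZ by (intro connected_open_diff_countable) auto
  qed
  have off_circle: "g z \<noteq> \<phi> w" if "z \<in> \<bbbD> - Z" "w \<in> sphere 0 1" for z w
    using L that by (auto simp: g_def Z_def field_simps)
  have cover: "g ` (\<bbbD> - Z) \<subseteq> \<phi> ` \<bbbD> \<union> - \<phi> ` cball 0 1"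
  proof (intro subsetI, rule ccontr)
    fix y assume "y \<in> g ` (\<bbbD> - Z)" and y: "y \<notin> \<phi> ` \<bbbD> \<union> - \<phi> ` cball 0 1"
    then obtain z where z: "z \<in> \<bbbD> - Z" "y = g z" by blast
    from y obtain w where w: "w \<in> cball 0 1" "y = \<phi> w" "w \<notin> \<bbbD>" by blast
    then show False using off_circle[of z w] z by simp
  qed
  have "\<phi> ` \<bbbD> \<subseteq> \<phi> ` cball 0 1" by (intro image_mono) auto
  then have "\<phi> ` \<bbbD> \<inter> (- \<phi> ` cball 0 1) \<inter> g ` (\<bbbD> - Z) = {}" by blast
  moreover have "open (- \<phi> ` cball 0 1)" using compact_imp_closed[OF cmp] by (rule open_Compl)
  \<comment> \<open>A connected set covered by two disjoint open sets lies in one of them; the value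
    \<open>g 0 = \<phi> 0\<close> decides which.\<close>
  ultimately have "\<phi> ` \<bbbD> \<inter> g ` (\<bbbD> - Z) = {} \<or> (- \<phi> ` cball 0 1) \<inter> g ` (\<bbbD> - Z) = {}"
    by (intro connectedD[OF con opn _ _ cover])
  moreover have "g 0 \<in> \<phi> ` \<bbbD>" using p0 q0 by (auto simp: g_def)
  moreover have "g 0 \<in> g ` (\<bbbD> - Z)" using q0 by (intro imageI) (simp add: Z_def)
  ultimately have img: "g ` (\<bbbD> - Z) \<subseteq> \<phi> ` \<bbbD>"
    using cover by (elim disjE) blast+
  have nz: "q z \<noteq> 0" if z: "z \<in> \<bbbD>" for z
  proof
    assume qz: "q z = 0"
    obtain C where C: "\<And>y. y \<in> \<phi> ` cball 0 1 \<Longrightarrow> norm y \<le> C"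
      using compact_imp_bounded[OF cmp] bounded_iff by metis
    \<comment> \<open>\<open>V\<close> is the open set where |p| <= C |q| fails. The bound holds off
      the countable set \<open>Z\<close>, so \<open>V\<close> cannot contain a ball.\<close>
    define V where "V = {x \<in> \<bbbD>. norm (p x) - C * norm (q x) > 0}"
    have "continuous_on \<bbbD> (\<lambda>x. norm (p x) - C * norm (q x))"
      using p q by (intro continuous_intros holomorphic_on_imp_continuous_on)
    then have "open (\<bbbD> \<inter> (\<lambda>x. norm (p x) - C * norm (q x)) -` {0<..})"
      by (intro continuous_open_preimage) auto
    also have "\<bbbD> \<inter> (\<lambda>x. norm (p x) - C * norm (q x)) -` {0<..} = V"
      by (auto simp: V_def)
    finally have "open V" .
    \<comment> \<open>The point 1 is an arbitrary choice on the circle: as \<open>q z = 0\<close>,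
      the hypothesis there just says that \<open>p z\<close> is nonzero.\<close>
    moreover have "z \<in> V" using L[rule_format, of 1 z] z qz by (auto simp: V_def)
    ultimately obtain e where "e > 0" "ball z e \<subseteq> V" by (auto elim: openE)
    moreover have "V \<subseteq> Z"
    proof
      fix x assume x: "x \<in> V"
      show "x \<in> Z"
      proof (rule ccontr)
        assume "x \<notin> Z"
        with x have x': "x \<in> \<bbbD> - Z" "q x \<noteq> 0" by (auto simp: V_def Z_def)
        then obtain w where w: "w \<in> \<bbbD>" "g x = \<phi> w" using img by blast
        have "\<phi> w \<in> \<phi> ` cball 0 1" using w by (intro imageI) simp
        then have "norm (g x) \<le> C" using C w by simp
        then show False using x x' by (simp add: V_def g_def norm_divide field_simps)
      qed
    qed
    ultimately have "countable (ball z e)" using countable_subset[OF _ cZ] by auto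
    then show False using uncountable_ball[OF \<open>e > 0\<close>] by blast
  qed
  then show "\<forall>z\<in>\<bbbD>. q z \<noteq> 0" by blast
  have gim: "g ` \<bbbD> \<subseteq> \<phi> ` \<bbbD>" using img nz by (auto simp: Z_def)
  have ghol: "g holomorphic_on \<bbbD>"
    unfolding g_def using p q nz by (intro holomorphic_intros) auto
  obtain \<psi> where \<psi>: "\<psi> holomorphic_on \<phi> ` \<bbbD>" "\<And>z. z \<in> \<bbbD> \<Longrightarrow> \<psi> (\<phi> z) = z"
    by (rule holomorphic_has_inverse[OF \<phi>(1) open_ball inj]) blast
  have hol: "(\<lambda>z. \<psi> (g z)) holomorphic_on \<bbbD>"
    using holomorphic_on_compose_gen[OF ghol \<psi>(1) gim] by (simp add: o_def)
  have val: "\<psi> (g z) \<in> \<bbbD> \<and> \<phi> (\<psi> (g z)) = g z" if z: "z \<in> \<bbbD>" for z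
  proof -
    from gim z obtain w where "w \<in> \<bbbD>" "g z = \<phi> w" by blast
    then show ?thesis using \<psi>(2) by simp
  qed
  \<comment> \<open>The normalization \<open>p0\<close> makes 0 a fixed point, as the Schwarz lemma
    requires.\<close>
  have "\<psi> (g 0) = 0" using p0 q0 \<psi>(2)[of 0] by (simp add: g_def)
  then have "norm (\<psi> (g z)) \<le> norm z" if "z \<in> \<bbbD>" for z
    using Schwarz_Lemma(1)[OF hol] val that by auto
  then have "schwarz_function (\<lambda>z. \<psi> (g z))"
    using hol by (simp add: schwarz_function_def analytic_on_open)
  then show "(\<lambda>z. p z / q z) \<prec>\<^sub>D \<phi>"
    unfolding subordinate_def using val by (auto simp: g_def[symmetric])
qed

text \<open>The conditionals put the true coefficients 0 and 1 of \<open>f\<close> in place of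
  \<open>a 0\<close> and \<open>a 1\<close>, giving a full power series to differentiate
  termwise.\<close>

lemma normalized_expansion_sums:
  assumes "normalized_expansion a f" and "z \<in> \<bbbD>"
  shows "(\<lambda>n. (if n = 0 then 0 else if n = 1 then 1 else a n) * z ^ n) sums f z"
  using sums_iff_shift[of "\<lambda>n. (if n = 0 then 0 else if n = 1 then 1 else a n) * z ^ n" 2 "f z - z"]
    assms unfolding normalized_expansion_def by (simp add: numeral_2_eq_2)

lemma normalized_expansion_deriv_sums:
  assumes a: "normalized_expansion a f" and f: "f holomorphic_on \<bbbD>" and z: "z \<in> \<bbbD>"
  shows "(\<lambda>n. of_nat (n + 2) * a (n + 2) * z ^ (n + 1)) sums (deriv f z - 1)"
proof -
  have "(\<lambda>n. diffs (\<lambda>n. if n = 0 then 0 else if n = 1 then 1 else a n) n * z ^ n) sums deriv f z"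
    using z by (intro termdiffs_sums_strong[where K = 1 and f = f] normalized_expansion_sums[OF a]
        holomorphic_derivI[OF f]) auto
  then show ?thesis
    using sums_Suc_iff[of "\<lambda>n. diffs (\<lambda>n. if n = 0 then 0 else if n = 1 then 1 else a n) n * z ^ n"
        "deriv f z - 1"]
    by (simp add: diffs_def)
qed

text \<open>This is \<open>h\<close> from the overview: filling in the limit at 0 makes it
  holomorphic on the whole disc for normalized \<open>f\<close>.\<close>

definition over_id :: "(complex \<Rightarrow> complex) \<Rightarrow> complex \<Rightarrow> complex" where
  "over_id f z = (if z = 0 then 1 else f z / z)"

lemma normalized_expansion_over_id_sums:
  assumes "normalized_expansion a f" and "z \<in> \<bbbD>"
  shows "(\<lambda>n. a (n + 2) * z ^ (n + 1)) sums (over_id f z - 1)"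
proof (cases "z = 0")
  case False
  have "(\<lambda>n. a (n + 2) * z ^ (n + 2)) sums (f z - z)"
    using assms by (simp add: normalized_expansion_def)
  from sums_divide[OF this, of z] False show ?thesis
    by (simp add: over_id_def diff_divide_distrib)
qed (simp add: over_id_def)

lemma holomorphic_over_id:
  assumes "normalized_expansion a f"
  shows "over_id f holomorphic_on \<bbbD>"
proof (rule power_series_holomorphic)
  fix z :: complex assume "z \<in> \<bbbD>"
  from normalized_expansion_over_id_sums[OF assms this]
  show "(\<lambda>n. (if n = 0 then 1 else a (n + 1)) * (z - 0) ^ n) sums over_id f z"
    using sums_Suc_iff[of "\<lambda>n. (if n = 0 then 1 else a (n + 1)) * z ^ n" "over_id f z - 1"] by simp
qed

lemma criterion_series_eq:
  assumes a: "normalized_expansion a f" and f: "f holomorphic_on \<bbbD>" and z: "z \<in> \<bbbD>"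
    and s: "s \<noteq> 0"
  shows "1 - (\<Sum>n. (of_nat (n + 2) - (1 + s)) / s * a (n + 2) * z ^ (n + 1)) =
         ((1 + s) * over_id f z - deriv f z) / s"
proof -
  have "(\<lambda>n. (of_nat (n + 2) * a (n + 2) * z ^ (n + 1) - (1 + s) * (a (n + 2) * z ^ (n + 1))) / s)
      sums ((deriv f z - 1 - (1 + s) * (over_id f z - 1)) / s)"
    by (intro sums_divide sums_diff sums_mult normalized_expansion_deriv_sums[OF a f z]
        normalized_expansion_over_id_sums[OF a z])
  also have "(\<lambda>n. (of_nat (n + 2) * a (n + 2) * z ^ (n + 1) - (1 + s) * (a (n + 2) * z ^ (n + 1))) / s) =
      (\<lambda>n. (of_nat (n + 2) - (1 + s)) / s * a (n + 2) * z ^ (n + 1))"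
    by (simp add: algebra_simps)
  finally have "(\<Sum>n. (of_nat (n + 2) - (1 + s)) / s * a (n + 2) * z ^ (n + 1)) =
      (deriv f z - 1 - (1 + s) * (over_id f z - 1)) / s"
    by (rule sums_unique[symmetric])
  \<comment> \<open>The constants -1 and 1 + s in the numerator add up to s, and s / s cancels the
    leading 1.\<close>
  then show ?thesis using s by (simp only:) (simp add: field_simps)
qed

lemma ball_sphere_iff_exp:
  "(\<forall>w\<in>sphere 0 1. P w) \<longleftrightarrow> (\<forall>\<theta>::real. 0 \<le> \<theta> \<and> \<theta> < 2 * pi \<longrightarrow> P (exp (\<i> * of_real \<theta>)))"
proof (intro iffI ballI allI impI)
  fix w :: complex
  assume P: "\<forall>\<theta>::real. 0 \<le> \<theta> \<and> \<theta> < 2 * pi \<longrightarrow> P (exp (\<i> * of_real \<theta>))" and "w \<in> sphere 0 1"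
  then have "w = exp (\<i> * of_real (Arg2pi w))" using Arg2pi_eq[of w] by simp
  then show "P w" using P Arg2pi_ge_0[of w] Arg2pi_lt_2pi[of w] by metis
qed simp

theorem theorem3:
  fixes f :: "complex \<Rightarrow> complex" and a :: "nat \<Rightarrow> complex"
  assumes "f \<in> class_A" and "normalized_expansion a f"
  shows "f \<in> class_G_sh \<longleftrightarrow>
    (\<forall>\<theta>::real. 0 \<le> \<theta> \<and> \<theta> < 2 * pi \<longrightarrow> (\<forall>z\<in>\<bbbD>.
      1 - (\<Sum>n. (of_nat (n + 2) - (1 + sinh (exp (\<i> * of_real \<theta>)))) / sinh (exp (\<i> * of_real \<theta>))
                 * a (n + 2) * z ^ (n + 1)) \<noteq> 0))"
proof -
  have f: "f holomorphic_on \<bbbD>"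
    using assms(1) by (auto simp: class_A_def intro: analytic_imp_holomorphic)
  have deriv0: "deriv f 0 = 1"
    using normalized_expansion_deriv_sums[OF assms(2) f, of 0] by (simp add: sums_iff)
  have sinh_nz: "sinh w \<noteq> 0" if "w \<in> sphere 0 1" for w :: complex
    using inj_onD[OF inj_on_sinh_cball, of w 0] that by auto
  have nonvanishing: "(\<forall>z\<in>\<bbbD> - {0}. f z \<noteq> 0) \<longleftrightarrow> (\<forall>z\<in>\<bbbD>. over_id f z \<noteq> 0)"
    by (auto simp: over_id_def)
  \<comment> \<open>At 0 both sides are 1 by \<open>deriv0\<close>; at other zeros of
    \<open>f\<close> both are 0 by the convention x / 0 = 0.\<close>
  have "zf'_over_f f z = deriv f z / over_id f z" for z
    by (simp add: zf'_over_f_def over_id_def deriv0)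
  \<comment> \<open>The summand 1 moves across the subordination with the same Schwarz
    function.\<close>
  then have "f \<in> class_G_sh \<longleftrightarrow> (\<forall>z\<in>\<bbbD>. over_id f z \<noteq> 0) \<and>
      (\<lambda>z. deriv f z / over_id f z) \<prec>\<^sub>D (\<lambda>w. 1 + sinh w)"
    using assms(1) unfolding class_G_sh_def nonvanishing[symmetric] subordinate_def
    by (simp add: algebra_simps)
  also have "\<dots> \<longleftrightarrow> (\<forall>w\<in>sphere 0 1. \<forall>z\<in>\<bbbD>. deriv f z \<noteq> (1 + sinh w) * over_id f z)"
  proof (rule avoids_circle_iff_subordinate[symmetric])
    show "over_id f holomorphic_on \<bbbD>" by (rule holomorphic_over_id[OF assms(2)])
    show "(\<lambda>w. 1 + sinh w) holomorphic_on \<bbbD>"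
      by (intro analytic_imp_holomorphic analytic_intros)
    show "inj_on (\<lambda>w::complex. 1 + sinh w) (cball 0 1)"
      using inj_on_sinh_cball by (auto simp: inj_on_def)
    show "continuous_on (cball 0 1) (\<lambda>w::complex. 1 + sinh w)"
      by (intro continuous_intros)
  qed (use deriv0 in \<open>auto simp: over_id_def intro!: holomorphic_deriv f\<close>)
  also have "\<dots> \<longleftrightarrow> (\<forall>w\<in>sphere 0 1. \<forall>z\<in>\<bbbD>.
      1 - (\<Sum>n. (of_nat (n + 2) - (1 + sinh w)) / sinh w * a (n + 2) * z ^ (n + 1)) \<noteq> 0)"
    by (intro ball_cong refl, subst criterion_series_eq[OF assms(2) f])
      (use sinh_nz in auto)
  finally show ?thesis unfolding ball_sphere_iff_exp .
qed

end
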